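(* Let $k$ be a field of characteristic $0$. The variety $\mathfrak{N}$ of Novikov algebras over $k$ is generated by the Novikov algebra $A=\langle k[x],\circ\rangle$, where $f\circ g=\partial(f)g$ and $\partial=\frac{d}{dx}$; that is, $\mathfrak{N}=\mathrm{Var}\,A$.
   Context: Algebras are $k$-vector spaces with a $k$-bilinear multiplication, not assumed associative or unital. A Novikov algebra is an algebra satisfying the identities $(xy)z-x(yz)=(xz)y-x(zy)$ and $x(yz)=y(xz)$; $\mathfrak{N}$ is the variety of all Novikov algebras over $k$. For an algebra $B$, $\mathrm{Var}\,B$ denotes the variety of algebras generated by $B$, i.e. the class of all $k$-algebras satisfying every polynomial identity (element of a free nonassociative algebra) satisfied by $B$. *)

theory Defs
  imports "HOL-Computational_Algebra.Polynomial" "HOL-Library.Poly_Mapping"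
begin

text \<open>The additive group of an algebra is that of its carrier type; the record supplies the
  remaining structure.\<close>

record ('k, 'a) alg =
  smul :: "'k \<Rightarrow> 'a \<Rightarrow> 'a"
  mul :: "'a \<Rightarrow> 'a \<Rightarrow> 'a"

definition nonassoc_algebra :: "('k::field, 'a::ab_group_add) alg \<Rightarrow> bool" where
  "nonassoc_algebra B \<longleftrightarrow>
     vector_space (smul B) \<and>
     (\<forall>x. Vector_Spaces.linear (smul B) (smul B) (\<lambda>y. mul B x y)) \<and>
     (\<forall>y. Vector_Spaces.linear (smul B) (smul B) (\<lambda>x. mul B x y))"

text \<open>\<open>'v magma\<close> is the set of nonassociative words in the variables \<open>'v\<close>. It is the basis of the
  free nonassociative (nonunital) algebra, whose elements are the finitely supported functions on it.
  Polynomial identities are elements of the free algebra in countably many variables.\<close>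

datatype 'v magma = Gen 'v | Prod "'v magma" "'v magma"

type_synonym ('k, 'v) free_nonassoc = "'v magma \<Rightarrow>\<^sub>0 'k"

definition free_mul ::
  "('k::field, 'v) free_nonassoc \<Rightarrow> ('k, 'v) free_nonassoc \<Rightarrow> ('k, 'v) free_nonassoc" where
  "free_mul f g = (\<Sum>s\<in>Poly_Mapping.keys f. \<Sum>t\<in>Poly_Mapping.keys g.
     Poly_Mapping.single (Prod s t) (Poly_Mapping.lookup f s * Poly_Mapping.lookup g t))"

definition free_alg :: "('k::field, ('k, 'v) free_nonassoc) alg" where
  "free_alg = \<lparr>smul = (\<lambda>c. Poly_Mapping.map ((*) c)), mul = free_mul\<rparr>"

primrec evaluate_magma :: "('k, 'a) alg \<Rightarrow> ('v \<Rightarrow> 'a) \<Rightarrow> 'v magma \<Rightarrow> 'a" where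
  "evaluate_magma B \<rho> (Gen v) = \<rho> v"
| "evaluate_magma B \<rho> (Prod s t) = mul B (evaluate_magma B \<rho> s) (evaluate_magma B \<rho> t)"

definition evaluate :: "('k::field, 'a::ab_group_add) alg \<Rightarrow> ('v \<Rightarrow> 'a) \<Rightarrow> ('k, 'v) free_nonassoc \<Rightarrow> 'a"
  where "evaluate B \<rho> f =
    (\<Sum>t\<in>Poly_Mapping.keys f. smul B (Poly_Mapping.lookup f t) (evaluate_magma B \<rho> t))"

definition satisfies :: "('k::field, 'a::ab_group_add) alg \<Rightarrow> ('k, nat) free_nonassoc \<Rightarrow> bool" where
  "satisfies B f \<longleftrightarrow> (\<forall>\<rho>. evaluate B \<rho> f = 0)"

text \<open>A variety is a proper class, so it is represented by its members on an arbitrary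
  carrier type \<open>'b\<close>.\<close>

definition Var :: "('k::field, 'a::ab_group_add) alg \<Rightarrow> ('k, 'b::ab_group_add) alg set" where
  "Var B = {C. nonassoc_algebra C \<and> (\<forall>f. satisfies B f \<longrightarrow> satisfies C f)}"

definition Novikov :: "('k::field, 'b::ab_group_add) alg set" where
  "Novikov = {C. nonassoc_algebra C \<and>
     (\<forall>x y z. mul C (mul C x y) z - mul C x (mul C y z) = mul C (mul C x z) y - mul C x (mul C z y)) \<and>
     (\<forall>x y z. mul C x (mul C y z) = mul C y (mul C x z))}"

definition poly_deriv_alg :: "('k::field, 'k poly) alg" where
  "poly_deriv_alg = \<lparr>smul = smult, mul = (\<lambda>f g. pderiv f * g)\<rparr>"

text \<open>\<open>evaluate B \<rho>\<close> is the homomorphism from the free algebra extending \<open>\<rho>\<close>.\<close>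

lemma evaluate_superset:
  assumes "nonassoc_algebra B" "finite S" "Poly_Mapping.keys f \<subseteq> S"
  shows "evaluate B \<rho> f = (\<Sum>t\<in>S. smul B (Poly_Mapping.lookup f t) (evaluate_magma B \<rho> t))"
proof -
  interpret vector_space "smul B" using assms(1) by (simp add: nonassoc_algebra_def)
  show ?thesis unfolding evaluate_def
    by (rule sum.mono_neutral_left) (use assms in \<open>auto simp: in_keys_iff\<close>)
qed

lemma evaluate_Gen:
  assumes "nonassoc_algebra B"
  shows "evaluate B \<rho> (Poly_Mapping.single (Gen v) 1) = \<rho> v"
proof -
  interpret vector_space "smul B" using assms(1) by (simp add: nonassoc_algebra_def)
  show ?thesis by (simp add: evaluate_def)
qed

lemma evaluate_single:
  assumes "nonassoc_algebra B"
  shows "evaluate B \<rho> (Poly_Mapping.single t c) = smul B c (evaluate_magma B \<rho> t)"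
proof -
  interpret vector_space "smul B" using assms(1) by (simp add: nonassoc_algebra_def)
  show ?thesis by (simp add: evaluate_def)
qed

lemma evaluate_add:
  assumes "nonassoc_algebra B"
  shows "evaluate B \<rho> (f + g) = evaluate B \<rho> f + evaluate B \<rho> g"
proof -
  interpret vector_space "smul B" using assms(1) by (simp add: nonassoc_algebra_def)
  let ?S = "Poly_Mapping.keys f \<union> Poly_Mapping.keys g"
  have "Poly_Mapping.keys (f + g) \<subseteq> ?S" by (rule Poly_Mapping.keys_add)
  then show ?thesis
    by (simp add: evaluate_superset[OF assms, of ?S] lookup_add scale_left_distrib sum.distrib)
qed

lemma evaluate_sum:
  assumes "nonassoc_algebra B"
  shows "evaluate B \<rho> (\<Sum>i\<in>I. f i) = (\<Sum>i\<in>I. evaluate B \<rho> (f i))"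
proof (induction I rule: infinite_finite_induct)
qed (simp_all add: evaluate_add[OF assms], simp_all add: evaluate_def)

lemma evaluate_smul:
  assumes "nonassoc_algebra B"
  shows "evaluate B \<rho> (smul free_alg c f) = smul B c (evaluate B \<rho> f)"
proof -
  interpret vector_space "smul B" using assms(1) by (simp add: nonassoc_algebra_def)
  let ?g = "Poly_Mapping.map ((*) c) f"
  have l: "Poly_Mapping.lookup ?g t = c * Poly_Mapping.lookup f t" for t
    by (simp add: Poly_Mapping.map.rep_eq when_def)
  have "Poly_Mapping.keys ?g \<subseteq> Poly_Mapping.keys f" by (auto simp: in_keys_iff l)
  then show ?thesis
    by (simp add: free_alg_def evaluate_superset[OF assms, of "Poly_Mapping.keys f"] l scale_sum_right)
qed

lemma evaluate_mul:
  assumes "nonassoc_algebra B"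
  shows "evaluate B \<rho> (mul free_alg f g) = mul B (evaluate B \<rho> f) (evaluate B \<rho> g)"
proof -
  interpret vector_space "smul B" using assms(1) by (simp add: nonassoc_algebra_def)
  have r: "Vector_Spaces.linear (smul B) (smul B) (\<lambda>y. mul B x y)" for x
    using assms by (simp add: nonassoc_algebra_def)
  have l: "Vector_Spaces.linear (smul B) (smul B) (\<lambda>x. mul B x y)" for y
    using assms by (simp add: nonassoc_algebra_def)
  have rs: "mul B x (\<Sum>i\<in>I. h i) = (\<Sum>i\<in>I. mul B x (h i))" for x I and h :: "_ \<Rightarrow> _"
    by (rule module_hom.sum[OF r[unfolded Vector_Spaces.linear_iff_module_hom]])
  have ls: "mul B (\<Sum>i\<in>I. h i) y = (\<Sum>i\<in>I. mul B (h i) y)" for y I and h :: "_ \<Rightarrow> _"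
    by (rule module_hom.sum[OF l[unfolded Vector_Spaces.linear_iff_module_hom]])
  have rc: "mul B x (smul B c y) = smul B c (mul B x y)" for x c y
    by (rule module_hom.scale[OF r[unfolded Vector_Spaces.linear_iff_module_hom]])
  have lc: "mul B (smul B c x) y = smul B c (mul B x y)" for x c y
    by (rule module_hom.scale[OF l[unfolded Vector_Spaces.linear_iff_module_hom]])
  show ?thesis
    by (simp add: free_alg_def free_mul_def evaluate_sum[OF assms] evaluate_single[OF assms])
      (simp add: evaluate_def rs ls rc lc scale_sum_right mult.commute, rule sum.swap)
qed

end

theory Submission imports Defs begin

text \<open>The product of the Novikov algebra on \<open>k[x]\<close> is \<open>f' g\<close>, so a word of length \<open>n\<close> evaluates there
  to a sum of differential monomials, products of \<open>n\<close> derivatives of the variables whose orders add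
  up to \<open>n - 1\<close>. Two facts show that this algebra has no identities beyond those valid in all
  Novikov algebras.

  In every Novikov algebra each of these monomials has a value, and the value of a word
  is the sum of the values of its monomials. This needs a monomial to be evaluated through products
  of the form \<open>f' g\<close> alone, with a result that does not depend on how it is done. The left
  multiplications, thought of as multiplication by \<open>a'\<close>, commute
  with each other, and they generate an algebra of operators that stands for the differential monomials
  of weight \<open>0\<close>. Right symmetry says that for such an operator \<open>s\<close> the expression
  \<open>(s a) b - s (a b)\<close>, which plays the role of \<open>s' a b\<close>, is symmetric in \<open>a\<close> and \<open>b\<close>. Hence
  \<open>x^(n) a\<^sub>1 \<dots> a\<^sub>n\<close> can be defined by recursion on \<open>n\<close> as a function of the multiset of the \<open>a\<^sub>i\<close>
  (lemma \<open>brace_add_mset\<close>), and any monomial is evaluated by replacing such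
  factors one after the other by single elements. The values multiply by the Leibniz rule
  (\<open>monomial_value_product\<close>).

  Over a field of characteristic \<open>0\<close>, differential monomials are linearly independent as functions
  on \<open>k[x]\<close>, because the derivatives of a polynomial at \<open>0\<close>, up to any given order, can be prescribed
  arbitrarily (\<open>differential_monomials_independent\<close>).

  So if \<open>f\<close> is an identity of \<open>k[x]\<close>, then after expanding its words the coefficient of every
  monomial vanishes, and then \<open>f\<close> vanishes in every Novikov algebra. The other inclusion holds since
  the defining laws of Novikov algebras are themselves identities.\<close>

section \<open>Operators generated by left multiplications\<close>

locale novikov_ring =
  fixes circ :: "'a::ab_group_add \<Rightarrow> 'a \<Rightarrow> 'a" (infixl "\<cdot>" 70)
  assumes add_left: "(a + b) \<cdot> c = a \<cdot> c + b \<cdot> c"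
    and add_right: "a \<cdot> (b + c) = a \<cdot> b + a \<cdot> c"
    and left_commute: "a \<cdot> (b \<cdot> c) = b \<cdot> (a \<cdot> c)"
    and right_symmetric: "(a \<cdot> b) \<cdot> c - a \<cdot> (b \<cdot> c) = (a \<cdot> c) \<cdot> b - a \<cdot> (c \<cdot> b)"
begin

lemma zero_left: "0 \<cdot> a = 0"
  using add_left[of 0 0 a] by simp

lemma zero_right: "a \<cdot> 0 = 0"
  using add_right[of a 0 0] by simp

lemma diff_right: "a \<cdot> (b - c) = a \<cdot> b - a \<cdot> c"
  using add_right[of a "b - c" c] by simp

lemma diff_left: "(b - c) \<cdot> a = b \<cdot> a - c \<cdot> a"
  using add_left[of "b - c" c a] by simp

lemma sum_mset_left: "(\<Sum>c\<in>#C. f c) \<cdot> a = (\<Sum>c\<in>#C. f c \<cdot> a)"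
  by (induction C) (simp_all add: zero_left add_left)

lemma sum_mset_right: "a \<cdot> (\<Sum>c\<in>#C. f c) = (\<Sum>c\<in>#C. a \<cdot> f c)"
  by (induction C) (simp_all add: zero_right add_right)

text \<open>In a differential algebra with \<open>a \<cdot> b = a' b\<close> these operators are multiplications by elements of
  weight \<open>0\<close>, where the weight of \<open>a^(i)\<close> is \<open>i - 1\<close>.\<close>
inductive left_op :: "('a \<Rightarrow> 'a) \<Rightarrow> bool" where
  mult: "left_op (\<lambda>w. u \<cdot> w)"
| diff: "left_op s \<Longrightarrow> left_op t \<Longrightarrow> left_op (\<lambda>w. s w - t w)"
| comp: "left_op s \<Longrightarrow> left_op t \<Longrightarrow> left_op (\<lambda>w. s (t w))"

lemma left_op_zero: "left_op (\<lambda>w. 0)"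
  using mult[of 0] by (simp add: zero_left)

lemma left_op_add:
  assumes "left_op s" "left_op t"
  shows "left_op (\<lambda>w. s w + t w)"
  using diff[OF assms(1) diff[OF left_op_zero assms(2)]] by simp

lemma left_op_sum_mset:
  "(\<And>c. c \<in># C \<Longrightarrow> left_op (f c)) \<Longrightarrow> left_op (\<lambda>w. \<Sum>c\<in>#C. f c w)"
  by (induction C) (simp_all add: left_op_zero left_op_add)

lemma left_op_additive: "left_op s \<Longrightarrow> s (a + b) = s a + s b"
  by (induction arbitrary: a b rule: left_op.induct) (simp_all add: add_right)

lemma left_op_diff: "left_op s \<Longrightarrow> s (a - b) = s a - s b"
  using left_op_additive[of s "a - b" b] by simp

lemma left_op_mult_commute: "left_op s \<Longrightarrow> s (u \<cdot> w) = u \<cdot> s w"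
  by (induction arbitrary: w rule: left_op.induct) (simp_all add: diff_right left_commute)

lemma left_op_commute: "left_op s \<Longrightarrow> left_op t \<Longrightarrow> s (t w) = t (s w)"
  by (induction arbitrary: w rule: left_op.induct)
    (simp_all add: left_op_mult_commute left_op_diff)

text \<open>Right symmetry passes from left multiplications to all operators. The induction works because
  of the Leibniz rule behind it: if \<open>s(a, b)\<close> denotes the difference \<open>s a \<cdot> b - s (a \<cdot> b)\<close>, then the
  difference for the composite of \<open>s\<close> and \<open>t\<close> is \<open>t (s(b, a)) + s (t(a, b))\<close>.\<close>
lemma left_op_right_symmetric:
  "left_op s \<Longrightarrow> s a \<cdot> b - s (a \<cdot> b) = s b \<cdot> a - s (b \<cdot> a)"
proof (induction arbitrary: a b rule: left_op.induct)
  case (mult u)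
  then show ?case by (rule right_symmetric)
next
  case (diff s t)
  have "(s a - t a) \<cdot> b - (s (a \<cdot> b) - t (a \<cdot> b))
      = (s a \<cdot> b - s (a \<cdot> b)) - (t a \<cdot> b - t (a \<cdot> b))" for a b
    by (simp add: diff_left)
  then show ?case by (simp only: diff.IH[of a b])
next
  case (comp s t)
  have half: "s (t a) \<cdot> b - s (t (a \<cdot> b))
      = t (s b \<cdot> a - s (b \<cdot> a)) + s (t a \<cdot> b - t (a \<cdot> b))" for a b
  proof -
    have "s (t a) \<cdot> b - s (t a \<cdot> b) = s b \<cdot> t a - s (b \<cdot> t a)"
      by (rule comp.IH(1))
    also have "\<dots> = t (s b \<cdot> a - s (b \<cdot> a))"
      using comp.hyps by (simp add: left_op_diff left_op_mult_commute left_op_commute[of s t])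
    finally show ?thesis
      using comp.hyps by (simp add: left_op_diff algebra_simps)
  qed
  have "t (s b \<cdot> a - s (b \<cdot> a)) = t (s a \<cdot> b - s (a \<cdot> b))"
    using comp.IH(1)[of a b] by simp
  moreover have "s (t a \<cdot> b - t (a \<cdot> b)) = s (t b \<cdot> a - t (b \<cdot> a))"
    using comp.IH(2)[of a b] by simp
  ultimately show ?case by (simp only: half)
qed

section \<open>Symmetric braces\<close>

lemma Suc_size_diff_single: "c \<in># C \<Longrightarrow> Suc (size (C - {#c#})) = size C"
  by (metis insert_DiffM size_add_mset)

text \<open>\<open>brace x {#a\<^sub>1, \<dots>, a\<^sub>n#}\<close> is what \<open>x^(n) a\<^sub>1 \<dots> a\<^sub>n\<close> would be in a differential algebra. The
  recursion solves the Leibniz rule for \<open>(x^(n) a\<^sub>1 \<dots> a\<^sub>n)' a\<close> for its leading term; the element \<open>a\<close>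
  to be split off is picked by choice, and \<open>brace_add_mset\<close> shows that any other would do.\<close>
function brace :: "'a \<Rightarrow> 'a multiset \<Rightarrow> 'a" where
  "brace x A = (if A = {#} then x else
     (let a = (SOME a. a \<in># A); C = A - {#a#} in
       brace x C \<cdot> a - (\<Sum>c\<in>#C. c \<cdot> brace x (add_mset a (C - {#c#})))))"
  by auto
termination
proof (relation "measure (\<lambda>(x, A). size A)", goal_cases)
  case (2 x A a C)
  then have "a \<in># A" by (metis multiset_nonemptyE someI)
  with 2 show ?case using Suc_size_diff_single[of a A] by simp
next
  case (3 x A a C c)
  then have "a \<in># A" by (metis multiset_nonemptyE someI)
  with 3 show ?case using Suc_size_diff_single[of a A] Suc_size_diff_single[of c C] by auto
qed simp
declare brace.simps [simp del]

lemma brace_empty [simp]: "brace x {#} = x"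
  by (simp add: brace.simps)

text \<open>Inserting an argument into a brace is an operator of weight \<open>0\<close>. This is needed for small braces
  while the recursion equation is known only for these, hence the bound \<open>n\<close>.\<close>
lemma left_op_brace_aux:
  assumes rec: "\<And>C a. size C \<le> n \<Longrightarrow> brace x (add_mset a C) =
    brace x C \<cdot> a - (\<Sum>c\<in>#C. c \<cdot> brace x (add_mset a (C - {#c#})))"
  shows "size C \<le> n \<Longrightarrow> left_op (\<lambda>w. brace x (add_mset w C))"
proof (induction "size C" arbitrary: C rule: less_induct)
  case less
  have "left_op (\<lambda>w. c \<cdot> brace x (add_mset w (C - {#c#})))" if "c \<in># C" for c
  proof -
    have "left_op (\<lambda>w. brace x (add_mset w (C - {#c#})))"
      using less Suc_size_diff_single[OF that] by simp
    then show ?thesis by (rule left_op.comp[OF left_op.mult])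
  qed
  then have "left_op (\<lambda>w. brace x C \<cdot> w - (\<Sum>c\<in>#C. c \<cdot> brace x (add_mset w (C - {#c#}))))"
    by (rule left_op.diff[OF left_op.mult left_op_sum_mset])
  then show ?case by (simp only: rec[OF less.prems])
qed

text \<open>Splitting off \<open>b\<close> or \<open>a\<close> from \<open>{#a, b#} + E\<close> yields sums that agree except for \<open>s a \<cdot> b - a \<cdot> s b\<close>
  against \<open>s b \<cdot> a - b \<cdot> s a\<close>, where \<open>s\<close> inserts an argument into the brace with \<open>E\<close>. These are equal
  by \<open>left_op_right_symmetric\<close>.\<close>
lemma brace_add_mset:
  "brace x (add_mset a C) = brace x C \<cdot> a - (\<Sum>c\<in>#C. c \<cdot> brace x (add_mset a (C - {#c#})))"
proof (induction "size C" arbitrary: a C rule: less_induct)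
  case less
  define b where "b = (SOME b. b \<in># add_mset a C)"
  have b: "b \<in># add_mset a C"
    unfolding b_def by (rule someI[of _ a]) simp
  have chosen: "brace x (add_mset a C) =
      brace x (add_mset a C - {#b#}) \<cdot> b
      - (\<Sum>c\<in>#add_mset a C - {#b#}. c \<cdot> brace x (add_mset b (add_mset a C - {#b#} - {#c#})))"
    by (subst brace.simps) (simp add: b_def Let_def)
  show ?case
  proof (cases "b = a")
    case True
    then show ?thesis using chosen by simp
  next
    case False
    with b obtain E where C: "C = add_mset b E"
      by (metis insert_DiffM insert_noteq_member)
    define s where "s w = brace x (add_mset w E)" for w
    have s: "left_op s"
      unfolding s_def
      by (rule left_op_brace_aux[of "size E"]) (simp_all add: less C)
    have sym: "s a \<cdot> b - a \<cdot> s b = s b \<cdot> a - b \<cdot> s a"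
      using left_op_right_symmetric[OF s, of a b] by (simp add: left_op_mult_commute[OF s])
    have rest: "(\<Sum>c\<in>#E. c \<cdot> brace x (add_mset b (add_mset a E - {#c#})))
        = (\<Sum>c\<in>#E. c \<cdot> brace x (add_mset a (add_mset b E - {#c#})))"
      by (intro arg_cong[where f = sum_mset] image_mset_cong) (simp add: add_mset_commute)
    define S where "S = (\<Sum>c\<in>#E. c \<cdot> brace x (add_mset a (add_mset b E - {#c#})))"
    have "brace x (add_mset a C) = (s a \<cdot> b - a \<cdot> s b) - S"
      using chosen False by (simp add: C s_def rest flip: S_def)
    also have "\<dots> = (s b \<cdot> a - b \<cdot> s a) - S"
      by (simp only: sym)
    finally show ?thesis
      using False by (simp add: C s_def S_def)
  qed
qed

lemma brace_single [simp]: "brace x {#a#} = x \<cdot> a"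
  using brace_add_mset[of x a "{#}"] by simp

lemma left_op_brace: "left_op (\<lambda>w. brace x (add_mset w C))"
  by (rule left_op_brace_aux[OF brace_add_mset order_refl])

end

section \<open>Differential monomials\<close>

text \<open>A multiset of pairs \<open>(a, i)\<close> represents the product of the derivatives \<open>a^(i)\<close>.
  By the Leibniz rule, its derivative is the sum of \<open>raise m p\<close> over its factors \<open>p\<close>.\<close>

definition raise :: "('a \<times> nat) multiset \<Rightarrow> 'a \<times> nat \<Rightarrow> ('a \<times> nat) multiset" where
  "raise m p = add_mset (fst p, Suc (snd p)) (m - {#p#})"

text \<open>A factor \<open>x^(r + 1)\<close> is recorded as \<open>(x, r)\<close>: it turns \<open>r + 1\<close> elements into one, thereby
  shortening a list of arguments by \<open>r\<close>.\<close>
definition factors :: "('a \<times> nat) multiset \<Rightarrow> ('a \<times> nat) multiset" where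
  "factors m = image_mset (map_prod id (\<lambda>i. i - 1)) (filter_mset (\<lambda>p. snd p \<noteq> 0) m)"

definition arguments :: "('a \<times> nat) multiset \<Rightarrow> 'a multiset" where
  "arguments m = image_mset fst (filter_mset (\<lambda>p. snd p = 0) m)"

text \<open>These are the monomials of weight \<open>-1\<close>, the weight of a single undifferentiated variable and
  of \<open>f' g\<close> whenever \<open>f\<close> and \<open>g\<close> have it.\<close>
definition balanced :: "('a \<times> nat) multiset \<Rightarrow> bool" where
  "balanced m \<longleftrightarrow> size m = Suc (\<Sum>p\<in>#m. snd p)"

abbreviation order_zero :: "'a multiset \<Rightarrow> ('a \<times> nat) multiset" where
  "order_zero A \<equiv> image_mset (\<lambda>a. (a, 0)) A"

lemma factors_simps [simp]:
  "factors {#} = {#}"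
  "factors (m + n) = factors m + factors n"
  "factors (add_mset (a, 0) m) = factors m"
  "factors (add_mset (a, Suc r) m) = add_mset (a, r) (factors m)"
  "factors (order_zero A) = {#}"
  by (simp_all add: factors_def) (induction A; simp)

lemma arguments_simps [simp]:
  "arguments {#} = {#}"
  "arguments (m + n) = arguments m + arguments n"
  "arguments (add_mset (a, 0) m) = add_mset a (arguments m)"
  "arguments (add_mset (a, Suc r) m) = arguments m"
  "arguments (order_zero A) = A"
  by (simp_all add: arguments_def) (induction A; simp)

lemma size_arguments_factors:
  "size m + (\<Sum>p\<in>#factors m. snd p) = size (arguments m) + (\<Sum>p\<in>#m. snd p)"
proof (induction m)
  case (add p m)
  then show ?case by (cases p; cases "snd p") auto
qed simp

text \<open>Weight \<open>-1\<close> means that the undifferentiated factors are just enough to be used up, down to one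
  element, by the differentiated ones.\<close>
lemma size_arguments:
  "balanced m \<Longrightarrow> size (arguments m) = Suc (\<Sum>p\<in>#factors m. snd p)"
  using size_arguments_factors[of m] by (simp add: balanced_def)

lemma sum_snd_order_zero [simp]: "(\<Sum>p\<in>#order_zero A. snd p) = 0"
  by (induction A) simp_all

lemma balanced_collect:
  "balanced (add_mset (x, size A) (order_zero A + n)) \<longleftrightarrow> balanced (add_mset (b, 0) n)"
  by (auto simp: balanced_def)

lemma balanced_raise_add:
  assumes "balanced m" "balanced n" "p \<in># m"
  shows "balanced (raise m p + n)"
proof -
  from assms(3) obtain k where m: "m = add_mset p k" by (meson mset_add)
  show ?thesis using assms(1,2) by (simp add: balanced_def raise_def m)
qed

section \<open>Values of monomials in a Novikov ring\<close>

lemma permutation_invariantI: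
  assumes "\<And>us a b vs. mset (us @ a # b # vs) = mset xs \<Longrightarrow> f (us @ a # b # vs) = f (us @ b # a # vs)"
    and "mset xs = mset ys"
  shows "f xs = f ys"
  using assms
proof (induction xs arbitrary: f ys)
  case (Cons x xs)
  then have "x \<in> set ys"
    by (metis list.set_intros(1) mset_eq_setD)
  then obtain us vs where ys: "ys = us @ x # vs"
    by (meson split_list)
  have front: "f (us @ x # vs) = f (x # us @ vs)" if "mset (us @ x # vs) = mset (x # xs)" for us vs
    using that
  proof (induction us arbitrary: vs rule: rev_induct)
    case (snoc u us)
    have "f ((us @ [u]) @ x # vs) = f (us @ x # u # vs)"
      using Cons.prems(1)[of us u x vs] snoc.prems by simp
    also have "\<dots> = f (x # us @ u # vs)"
      using snoc.IH[of "u # vs"] snoc.prems by simp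
    finally show ?case by simp
  qed simp
  have "f (x # xs) = f (x # us @ vs)"
  proof (rule Cons.IH[of "\<lambda>zs. f (x # zs)"])
    fix us a b vs assume "mset (us @ a # b # vs) = mset xs"
    then show "f (x # us @ a # b # vs) = f (x # us @ b # a # vs)"
      using Cons.prems(1)[of "x # us" a b vs] by simp
  qed (use Cons.prems(2) ys in simp)
  also have "\<dots> = f ys"
    using front Cons.prems(2) ys by simp
  finally show ?case .
qed simp

context novikov_ring
begin

text \<open>\<open>contract xs zs\<close> evaluates the product of the factors \<open>xs\<close> and the arguments \<open>zs\<close>:
  each factor \<open>x^(r + 1)\<close> in turn absorbs the first \<open>r + 1\<close> elements of the list into a single brace.
  When the lengths match, one element remains at the end.\<close>
fun contract :: "('a \<times> nat) list \<Rightarrow> 'a list \<Rightarrow> 'a" where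
  "contract [] zs = hd zs"
| "contract ((x, r) # xs) zs =
    contract xs (brace x (mset (take (Suc r) zs)) # drop (Suc r) zs)"

text \<open>All maps that \<open>contract\<close> applies to its first argument are operators of weight \<open>0\<close>, so they
  commute with any other such operator.\<close>
lemma contract_left_op:
  assumes "left_op s"
  shows "contract xs (s z # zs) = s (contract xs (z # zs))"
proof (induction xs arbitrary: z zs)
  case (Cons xr xs)
  obtain x r where xr: "xr = (x, r)" by fastforce
  have "brace x (add_mset (s z) C) = s (brace x (add_mset z C))" for C
    using left_op_commute[OF assms left_op_brace, of x z C] by simp
  then show ?case by (simp add: xr Cons.IH)
qed simp

lemma contract_add:
  "contract xs ((a + b) # zs) = contract xs (a # zs) + contract xs (b # zs)"
proof (induction xs arbitrary: a b zs)
  case (Cons xr xs)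
  obtain x r where xr: "xr = (x, r)" by fastforce
  have "brace x (add_mset (a + b) C) = brace x (add_mset a C) + brace x (add_mset b C)" for C
    by (rule left_op_additive[OF left_op_brace])
  then show ?case by (simp add: xr Cons.IH)
qed simp

text \<open>Since the first factor acts on the first argument by an operator, it may be applied last.
  This makes the order of the factors irrelevant.\<close>
lemma contract_Cons:
  "contract ((x, r) # xs) (z # zs) =
    brace x (add_mset (contract xs (z # drop r zs)) (mset (take r zs)))"
  using contract_left_op[OF left_op_brace, of xs x z "mset (take r zs)" "drop r zs"] by simp

text \<open>The only exchange that matters is that of the last argument taken by the first factor with the
  first one left over. Pulling the operator of that factor out by \<open>contract_left_op\<close> makes both of
  them arguments of the remaining factors, where they may be exchanged by induction.\<close>
lemma contract_swap_args:
  "length us + length vs + 1 = (\<Sum>(x, r)\<leftarrow>xs. r) \<Longrightarrow>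
    contract xs (us @ a # b # vs) = contract xs (us @ b # a # vs)"
proof (induction xs arbitrary: us vs a b)
  case (Cons xr xs)
  obtain x r where xr: "xr = (x, r)" by fastforce
  define k where "k = length us"
  consider "Suc k < Suc r" | "k = r" | "Suc r \<le> k" by linarith
  then show ?case
  proof cases
    case 1
    then obtain j where "r = Suc (k + j)"
      using less_imp_Suc_add by auto
    then show ?thesis by (simp add: xr k_def add_mset_commute del: take_Suc drop_Suc)
  next
    case 2
    \<comment> \<open>\<open>a\<close> is the last argument taken by \<open>x\<close>, and \<open>b\<close> the first one left over\<close>
    let ?s = "\<lambda>w. brace x (add_mset w (mset us))"
    have s: "left_op ?s" by (rule left_op_brace)
    have "contract xs (?s a # b # vs) = ?s (contract xs ([] @ a # b # vs))"
      by (simp add: contract_left_op[OF s])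
    also have "\<dots> = ?s (contract xs ([] @ b # a # vs))"
      using Cons.IH[of "[]" vs a b] Cons.prems 2 by (simp add: xr k_def)
    also have "\<dots> = contract xs (?s b # a # vs)"
      by (simp add: contract_left_op[OF s])
    finally show ?thesis using 2 by (simp add: xr k_def Suc_diff_le)
  next
    case 3
    then have "drop (Suc r) (us @ a # b # vs) = drop (Suc r) us @ a # b # vs"
      "drop (Suc r) (us @ b # a # vs) = drop (Suc r) us @ b # a # vs"
      "take (Suc r) (us @ b # a # vs) = take (Suc r) us"
      "take (Suc r) (us @ a # b # vs) = take (Suc r) us"
      by (simp_all add: k_def)
    then show ?thesis
      using Cons.IH[of "brace x (mset (take (Suc r) us)) # drop (Suc r) us" vs a b] Cons.prems 3
      by (simp add: xr k_def del: take_Suc drop_Suc)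
  qed
qed simp

text \<open>By \<open>contract_Cons\<close> two consecutive factors act by commuting operators. Exchanging
  them also exchanges the blocks of arguments that they take, which is harmless by \<open>contract_swap_args\<close>.\<close>
lemma contract_swap_factors:
  assumes "length zs = Suc (\<Sum>(x, r)\<leftarrow>ps @ p # q # qs. r)"
  shows "contract (ps @ p # q # qs) zs = contract (ps @ q # p # qs) zs"
  using assms
proof (induction ps arbitrary: zs)
  case Nil
  obtain x r y t where pq: "p = (x, r)" "q = (y, t)" by fastforce
  from Nil obtain z R where zs: "zs = z # R" by (cases zs) auto
  define R1 R2 R3 where "R1 = take r R" and "R2 = take t (drop r R)" and "R3 = drop t (drop r R)"
  have R: "R = R1 @ R2 @ R3"
    unfolding R1_def R2_def R3_def by (metis append_take_drop_id)
  have len: "length R1 = r" "length R2 = t"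
    using Nil by (simp_all add: pq zs R1_def R2_def)
  have "contract (q # p # qs) zs = contract (q # p # qs) (z # R2 @ R1 @ R3)"
  proof (rule permutation_invariantI[of zs])
    fix us a b vs assume "mset (us @ a # b # vs) = mset zs"
    from arg_cong[OF this, of size]
    show "contract (q # p # qs) (us @ a # b # vs) = contract (q # p # qs) (us @ b # a # vs)"
      using Nil by (intro contract_swap_args) (simp add: pq)
  qed (simp add: zs R)
  also have "\<dots> = contract (p # q # qs) zs"
    unfolding pq zs R contract_Cons using len
    by (simp add: left_op_commute[OF left_op_brace[of y "mset R2"] left_op_brace[of x "mset R1"]])
  finally show ?case by simp
next
  case (Cons xr ps)
  obtain x r where xr: "xr = (x, r)" by fastforce
  show ?case using Cons by (simp add: xr)
qed

lemma contract_permutation: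
  assumes "length zs = Suc (\<Sum>p\<in>#mset xs. snd p)" "mset xs = mset xs'" "mset zs = mset zs'"
  shows "contract xs zs = contract xs' zs'"
proof -
  have sum: "(\<Sum>(x, r)\<leftarrow>ys. r) = (\<Sum>p\<in>#mset ys. snd p)" for ys :: "('a \<times> nat) list"
    by (simp add: case_prod_beta' flip: sum_mset_sum_list)
  have "contract xs zs = contract xs zs'"
  proof (rule permutation_invariantI[OF _ assms(3)])
    fix us a b vs assume "mset (us @ a # b # vs) = mset zs"
    from arg_cong[OF this, of size]
    show "contract xs (us @ a # b # vs) = contract xs (us @ b # a # vs)"
      using assms(1) by (intro contract_swap_args) (simp add: sum)
  qed
  also have "\<dots> = contract xs' zs'"
  proof (rule permutation_invariantI[OF _ assms(2), where f = "\<lambda>xs. contract xs zs'"])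
    fix ps p q qs assume eq: "mset (ps @ p # q # qs) = mset xs"
    show "contract (ps @ p # q # qs) zs' = contract (ps @ q # p # qs) zs'"
      using assms(1) mset_eq_length[OF assms(3)]
      by (intro contract_swap_factors) (simp only: sum eq)
  qed
  finally show ?thesis .
qed

text \<open>The orders in which factors and arguments are listed are chosen arbitrarily; by
  \<open>contract_permutation\<close> they do not matter when the monomial is balanced.\<close>
definition monomial_value :: "('a \<times> nat) multiset \<Rightarrow> 'a" where
  "monomial_value m =
    contract (SOME xs. mset xs = factors m) (SOME zs. mset zs = arguments m)"

lemma monomial_value_eq_contract:
  assumes "balanced m" "mset xs = factors m" "mset zs = arguments m"
  shows "monomial_value m = contract xs zs"
proof -
  have xs: "mset (SOME xs. mset xs = factors m) = factors m"
    by (rule someI[of _ xs]) (rule assms)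
  have zs: "mset (SOME zs. mset zs = arguments m) = arguments m"
    by (rule someI[of _ zs]) (rule assms)
  have "length (SOME zs. mset zs = arguments m) = size (arguments m)"
    by (metis zs size_mset)
  then show ?thesis
    unfolding monomial_value_def
    by (intro contract_permutation) (simp_all add: xs zs assms size_arguments)
qed

lemma monomial_value_single: "monomial_value {#(z, 0)#} = z"
  by (subst monomial_value_eq_contract[of _ "[]" "[z]"]) (simp_all add: balanced_def)

text \<open>Together with \<open>monomial_value_single\<close> this rule determines the values of all monomials of weight
  \<open>-1\<close> by the induction \<open>balanced_induct\<close>.\<close>
lemma monomial_value_collect:
  assumes "balanced (add_mset (brace x A, 0) n)"
  shows "monomial_value (add_mset (x, size A) (order_zero A + n))
    = monomial_value (add_mset (brace x A, 0) n)"
proof (cases "size A")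
  case (Suc r)
  obtain as xs zs where lists: "mset as = A" "mset xs = factors n" "mset zs = arguments n"
    by (metis ex_mset)
  have len: "length as = Suc r"
    using lists(1) Suc by auto
  have "balanced (add_mset (x, size A) (order_zero A + n))"
    using assms by (simp add: balanced_collect[where b = "brace x A"])
  then have "monomial_value (add_mset (x, size A) (order_zero A + n))
      = contract ((x, r) # xs) (as @ zs)"
    by (rule monomial_value_eq_contract) (simp_all add: lists Suc)
  also have "\<dots> = contract xs (brace x A # zs)"
    using len by (simp add: lists)
  also have "\<dots> = monomial_value (add_mset (brace x A, 0) n)"
    by (rule monomial_value_eq_contract[symmetric]) (simp_all add: lists assms)
  finally show ?thesis .
qed simp

lemma balanced_replace: "balanced (add_mset (a, i) n) \<longleftrightarrow> balanced (add_mset (b, i) n)"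
  by (simp add: balanced_def)

lemma monomial_value_add:
  assumes "balanced (add_mset (a, 0) n)"
  shows "monomial_value (add_mset (a + b, 0) n)
    = monomial_value (add_mset (a, 0) n) + monomial_value (add_mset (b, 0) n)"
proof -
  obtain xs zs where lists: "mset xs = factors n" "mset zs = arguments n"
    by (metis ex_mset)
  have "monomial_value (add_mset (c, 0) n) = contract xs (c # zs)" for c
    by (rule monomial_value_eq_contract)
      (use assms in \<open>simp_all add: lists balanced_replace[of c _ _ a]\<close>)
  then show ?thesis by (simp add: contract_add)
qed

lemma monomial_value_sum_mset:
  assumes "balanced (add_mset (a, 0) n)"
  shows "monomial_value (add_mset (\<Sum>c\<in>#C. f c, 0) n)
    = (\<Sum>c\<in>#C. monomial_value (add_mset (f c, 0) n))"
proof (induction C)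
  case empty
  have "balanced (add_mset (0, 0) n)"
    using assms by (simp add: balanced_replace[of 0 _ _ a])
  from monomial_value_add[OF this, of 0] show ?case by simp
next
  case (add c C)
  have "balanced (add_mset (f c, 0) n)"
    using assms by (simp add: balanced_replace[of "f c" _ _ a])
  with add show ?case by (simp add: monomial_value_add)
qed

text \<open>A monomial of weight \<open>-1\<close> with a factor \<open>x^(i)\<close>, \<open>i > 0\<close>, has at least \<open>i\<close> undifferentiated
  factors (see \<open>size_arguments\<close>), which can be collected with \<open>x\<close> into a brace. This makes it shorter.\<close>
lemma balanced_induct [consumes 1, case_names single collect]:
  assumes "balanced m"
    and single: "\<And>z. P {#(z, 0)#}"
    and collect: "\<And>x A n. balanced (add_mset (brace x A, 0) n) \<Longrightarrow>
      P (add_mset (brace x A, 0) n) \<Longrightarrow> P (add_mset (x, size A) (order_zero A + n))"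
  shows "P m"
  using assms(1)
proof (induction "size m" arbitrary: m rule: less_induct)
  case less
  show ?case
  proof (cases "\<exists>p\<in>#m. snd p \<noteq> 0")
    case False
    then have "(\<Sum>p\<in>#m. snd p) = 0" by simp
    with less.prems have "size m = 1" by (simp add: balanced_def)
    then obtain p where "m = {#p#}" by (metis One_nat_def size_1_singleton_mset)
    with False single[of "fst p"] show ?thesis by (cases p) simp
  next
    case True
    then obtain x r k where m: "m = add_mset (x, Suc r) k"
      by (metis multi_member_split not0_implies_Suc prod.exhaust_sel)
    define Z where "Z = filter_mset (\<lambda>p. snd p = 0) k"
    have "size Z = size (arguments m)"
      by (simp add: Z_def m arguments_def)
    then have "Suc r \<le> size Z"
      using size_arguments[OF less.prems] by (simp add: m)
    moreover obtain zs where zs: "mset zs = Z" by (metis ex_mset)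
    ultimately have len: "length (take (Suc r) zs) = Suc r" by auto
    define A where "A = image_mset fst (mset (take (Suc r) zs))"
    have sub: "mset (take (Suc r) zs) \<subseteq># Z"
      by (metis zs append_take_drop_id mset_append mset_subset_eq_add_left)
    have "order_zero A = mset (take (Suc r) zs)"
      unfolding A_def multiset.map_comp
    proof (rule trans[OF image_mset_cong multiset.map_ident])
      fix p assume "p \<in># mset (take (Suc r) zs)"
      then have "p \<in># Z" using sub by (meson mset_subset_eqD)
      then show "((\<lambda>a. (a, 0)) \<circ> fst) p = p" by (cases p) (auto simp: Z_def)
    qed
    with sub have "order_zero A \<subseteq># k"
      by (metis Z_def multiset_filter_subset subset_mset.order_trans)
    then obtain n where k: "k = order_zero A + n"
      by (metis subset_mset.add_diff_inverse)
    have size: "size A = Suc r"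
      using len by (simp add: A_def)
    have m': "m = add_mset (x, size A) (order_zero A + n)"
      by (simp add: m k size)
    have bal: "balanced (add_mset (brace x A, 0) n)"
      using less.prems by (simp add: m' balanced_collect[where b = "brace x A"])
    have "size (add_mset (brace x A, 0) n) < size m"
      by (simp add: m' size)
    from collect[OF bal less.hyps[OF this bal]] show ?thesis
      by (simp add: m')
  qed
qed

lemma monomial_value_substitute:
  assumes "balanced k" "balanced (add_mset (monomial_value k, 0) m)"
  shows "monomial_value (add_mset (monomial_value k, 0) m) = monomial_value (m + k)"
  using assms
proof (induction rule: balanced_induct)
  case (single z)
  then show ?case by (simp add: monomial_value_single)
next
  case (collect x A n)
  let ?b = "brace x A"
  have eq: "monomial_value (add_mset (x, size A) (order_zero A + n))
      = monomial_value (add_mset (?b, 0) n)"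
    by (rule monomial_value_collect[OF collect.hyps])
  have bal: "balanced (add_mset (?b, 0) (m + n))"
    using collect.hyps collect.prems by (simp add: balanced_def)
  have "monomial_value (m + add_mset (x, size A) (order_zero A + n))
      = monomial_value (add_mset (x, size A) (order_zero A + (m + n)))"
    by (simp add: ac_simps)
  also have "\<dots> = monomial_value (m + add_mset (?b, 0) n)"
    using monomial_value_collect[OF bal] by simp
  finally show ?case
    using collect.IH collect.prems by (simp only: eq)
qed

text \<open>The Leibniz rule, with \<open>w\<close> as a further factor. In the induction step, differentiating
  the element \<open>b = brace x A\<close> inside the monomial has to be compared with differentiating \<open>x\<close> and the
  elements of \<open>A\<close> separately, and \<open>b \<cdot> w\<close> splits accordingly by the recursion equation of the brace.\<close>
lemma monomial_value_mult:
  assumes "balanced m"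
  shows "monomial_value m \<cdot> w = (\<Sum>p\<in>#m. monomial_value (add_mset (w, 0) (raise m p)))"
  using assms
proof (induction rule: balanced_induct)
  case (single z)
  have "monomial_value (add_mset (z, size {#w#}) (order_zero {#w#} + {#}))
      = monomial_value {#(brace z {#w#}, 0)#}"
    by (rule monomial_value_collect) (simp add: balanced_def)
  then show ?case
    by (simp add: monomial_value_single raise_def add_mset_commute)
next
  case (collect x A n)
  define b m where "b = brace x A" and "m = add_mset (x, size A) (order_zero A + n)"
  have bal: "balanced (add_mset (c, 0) n)" for c
    using collect.hyps by (simp add: balanced_def)
  have differentiate: "monomial_value (add_mset (c, Suc 0) (add_mset (w, 0) k))
      = monomial_value (add_mset (c \<cdot> w, 0) k)"
    if "balanced (add_mset (c, 0) k)" for c k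
  proof -
    have "balanced (add_mset (brace c {#w#}, 0) k)"
      using that by (simp add: balanced_def)
    from monomial_value_collect[OF this] show ?thesis by simp
  qed
  have bw: "b \<cdot> w = brace x (add_mset w A) + (\<Sum>c\<in>#A. brace x (add_mset (c \<cdot> w) (A - {#c#})))"
    using brace_add_mset[of x w A] left_op_mult_commute[OF left_op_brace]
    by (simp add: b_def)
  have top: "monomial_value (add_mset (brace x (add_mset w A), 0) n)
      = monomial_value (add_mset (w, 0) (raise m (x, size A)))"
    using monomial_value_collect[OF bal, of x "add_mset w A"]
    by (simp add: raise_def m_def add_mset_commute)
  have inner: "monomial_value (add_mset (brace x (add_mset (c \<cdot> w) (A - {#c#})), 0) n)
      = monomial_value (add_mset (w, 0) (raise m (c, 0)))" if "c \<in># A" for c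
  proof -
    from that obtain D where A: "A = add_mset c D" by (meson mset_add)
    define k where "k = add_mset (x, size A) (order_zero D + n)"
    have balk: "balanced (add_mset (c, 0) k)"
      using bal[of c] by (simp add: balanced_def k_def A)
    have "monomial_value (add_mset (brace x (add_mset (c \<cdot> w) D), 0) n)
        = monomial_value (add_mset (c \<cdot> w, 0) k)"
      using monomial_value_collect[OF bal, of x "add_mset (c \<cdot> w) D"]
      by (simp add: k_def A add_mset_commute)
    also have "\<dots> = monomial_value (add_mset (c, Suc 0) (add_mset (w, 0) k))"
      by (rule differentiate[OF balk, symmetric])
    finally show ?thesis
      by (simp add: A raise_def m_def k_def add_mset_commute)
  qed
  have outer: "monomial_value (add_mset (w, 0) (raise (add_mset (b, 0) n) p))
      = monomial_value (add_mset (w, 0) (raise m p))" if "p \<in># n" for p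
  proof -
    from that obtain k where n: "n = add_mset p k" by (meson mset_add)
    have "balanced (add_mset (brace x A, 0)
        (add_mset (w, 0) (add_mset (fst p, Suc (snd p)) k)))"
      using bal[of "brace x A"] by (simp add: balanced_def n)
    from monomial_value_collect[OF this] show ?thesis
      by (simp add: raise_def m_def n b_def add_mset_commute)
  qed
  have "monomial_value m \<cdot> w = monomial_value (add_mset (b, 0) n) \<cdot> w"
    using monomial_value_collect[OF collect.hyps] by (simp add: m_def b_def)
  also have "\<dots> = monomial_value (add_mset (b, Suc 0) (add_mset (w, 0) n))
      + (\<Sum>p\<in>#n. monomial_value (add_mset (w, 0) (raise (add_mset (b, 0) n) p)))"
    using collect.IH by (simp add: b_def raise_def add_mset_commute)
  also have "\<dots> = monomial_value (add_mset (b \<cdot> w, 0) n)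
      + (\<Sum>p\<in>#n. monomial_value (add_mset (w, 0) (raise m p)))"
    by (simp add: differentiate[OF bal] outer cong: multiset.map_cong)
  also have "monomial_value (add_mset (b \<cdot> w, 0) n)
      = monomial_value (add_mset (w, 0) (raise m (x, size A)))
        + (\<Sum>c\<in>#A. monomial_value (add_mset (w, 0) (raise m (c, 0))))"
    unfolding bw monomial_value_add[OF bal] monomial_value_sum_mset[OF bal] top
    by (simp add: inner cong: multiset.map_cong)
  finally show ?case
    by (simp add: m_def multiset.map_comp comp_def add.assoc)
qed

text \<open>The values multiply like the monomials themselves under \<open>f \<cdot> g = f' g\<close>: they define a
  homomorphism from the differential polynomials of weight \<open>-1\<close>.\<close>
lemma monomial_value_product:
  assumes "balanced m" "balanced k"
  shows "monomial_value m \<cdot> monomial_value k = (\<Sum>p\<in>#m. monomial_value (raise m p + k))"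
proof -
  have "monomial_value (add_mset (monomial_value k, 0) (raise m p)) = monomial_value (raise m p + k)"
    if "p \<in># m" for p
  proof (rule monomial_value_substitute[OF assms(2)])
    have "balanced {#(monomial_value k, 0)#}" by (simp add: balanced_def)
    from balanced_raise_add[OF assms(1) this that]
    show "balanced (add_mset (monomial_value k, 0) (raise m p))" by simp
  qed
  then show ?thesis
    by (simp add: monomial_value_mult[OF assms(1)] cong: multiset.map_cong)
qed

end

section \<open>Differential monomials of polynomials\<close>

lemma pderiv_sum_mset: "pderiv (\<Sum>m\<in>#M. f m) = (\<Sum>m\<in>#M. pderiv (f m))"
  by (induction M) (simp_all add: pderiv_add)

lemma pderiv_prod_mset:
  "pderiv (\<Prod>p\<in>#m. f p) = (\<Sum>p\<in>#m. pderiv (f p) * (\<Prod>q\<in>#m - {#p#}. f q))"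
proof (induction m)
  case (add a m)
  have "(\<Sum>p\<in>#m. pderiv (f p) * (\<Prod>q\<in>#add_mset a m - {#p#}. f q))
      = (\<Sum>p\<in>#m. f a * (pderiv (f p) * (\<Prod>q\<in>#m - {#p#}. f q)))"
    by (intro arg_cong[where f = sum_mset] image_mset_cong) (simp add: ac_simps)
  then show ?case
    by (simp add: pderiv_mult add.IH sum_mset_distrib_left ac_simps)
qed simp

definition differential_monomial ::
  "('v \<Rightarrow> 'k::idom poly) \<Rightarrow> ('v \<times> nat) multiset \<Rightarrow> 'k poly" where
  "differential_monomial \<rho> m = (\<Prod>p\<in>#m. (pderiv ^^ snd p) (\<rho> (fst p)))"

lemma pderiv_differential_monomial:
  "pderiv (differential_monomial \<rho> m) = (\<Sum>p\<in>#m. differential_monomial \<rho> (raise m p))"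
  by (simp add: differential_monomial_def pderiv_prod_mset raise_def)

text \<open>Kronecker substitution: the weights are such that the weighted sum of a multiset of size at most
  \<open>N\<close> lists its multiplicities as digits to the base \<open>N + 1\<close>.\<close>
lemma ex_separating_weight_bounded:
  assumes "finite V"
  shows "\<exists>w :: 'a \<Rightarrow> nat. \<forall>m n. set_mset m \<subseteq> V \<longrightarrow> set_mset n \<subseteq> V \<longrightarrow>
    size m \<le> N \<longrightarrow> size n \<le> N \<longrightarrow> (\<Sum>x\<in>#m. w x) = (\<Sum>x\<in>#n. w x) \<longrightarrow> m = n"
  using assms
proof (induction V rule: finite_induct)
  case (insert a V)
  then obtain w :: "'a \<Rightarrow> nat" where w: "set_mset m \<subseteq> V \<Longrightarrow> set_mset n \<subseteq> V \<Longrightarrow> size m \<le> N \<Longrightarrow> size n \<le> N \<Longrightarrow>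
    (\<Sum>x\<in>#m. w x) = (\<Sum>x\<in>#n. w x) \<Longrightarrow> m = n" for m n
    by blast
  \<comment> \<open>\<open>a\<close> is given the last digit, and the other digits are shifted\<close>
  define u where "u x = (if x = a then 1 else Suc N * w x)" for x
  define rest where "rest m = filter_mset (\<lambda>x. x \<noteq> a) m" for m
  have u: "(\<Sum>x\<in>#m. u x) = count m a + Suc N * (\<Sum>x\<in>#rest m. w x)" for m
    by (induction m) (simp_all add: u_def rest_def algebra_simps)
  show ?case
  proof (intro exI[of _ u] allI impI)
    fix m n
    assume sub: "set_mset m \<subseteq> insert a V" "set_mset n \<subseteq> insert a V"
      and size: "size m \<le> N" "size n \<le> N"
      and eq: "(\<Sum>x\<in>#m. u x) = (\<Sum>x\<in>#n. u x)"
    have digit: "count k a < Suc N" if "size k \<le> N" for k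
      using count_le_size[of k a] that by linarith
    have cm: "count m a = count n a"
      using arg_cong[OF eq, of "\<lambda>s. s mod Suc N"] digit[OF size(1)] digit[OF size(2)]
      unfolding u by (simp del: mult_Suc)
    then have "(\<Sum>x\<in>#rest m. w x) = (\<Sum>x\<in>#rest n. w x)"
      using eq unfolding u by (simp del: mult_Suc)
    then have "rest m = rest n"
      using sub size by (intro w) (auto simp: rest_def intro: order_trans[OF size_filter_mset_lesseq])
    have "count m x = count n x" for x
      using cm arg_cong[OF \<open>rest m = rest n\<close>, of "\<lambda>k. count k x"]
      by (cases "x = a") (simp_all add: rest_def)
    then show "m = n" by (rule multiset_eqI)
  qed
qed auto

lemma ex_separating_weight:
  assumes "finite M"
  shows "\<exists>w :: 'a \<Rightarrow> nat. inj_on (\<lambda>m. \<Sum>x\<in>#m. w x) M"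
proof -
  have "finite (\<Union>m\<in>M. set_mset m)"
    using assms by simp
  from ex_separating_weight_bounded[OF this, of "Max (size ` M)"]
  obtain w :: "'a \<Rightarrow> nat" where w: "\<And>m n. set_mset m \<subseteq> (\<Union>m\<in>M. set_mset m) \<Longrightarrow>
      set_mset n \<subseteq> (\<Union>m\<in>M. set_mset m) \<Longrightarrow> size m \<le> Max (size ` M) \<Longrightarrow> size n \<le> Max (size ` M) \<Longrightarrow>
      (\<Sum>x\<in>#m. w x) = (\<Sum>x\<in>#n. w x) \<Longrightarrow> m = n"
    by blast
  have "inj_on (\<lambda>m. \<Sum>x\<in>#m. w x) M"
    by (intro inj_onI w) (use assms in auto)
  then show ?thesis by (rule exI[of _ w])
qed

lemma ex_polynomial_jet:
  "\<exists>f :: 'k::field_char_0 poly. \<forall>i\<le>K. poly ((pderiv ^^ i) f) 0 = a i"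
proof (intro exI[of _ "\<Sum>j\<le>K. monom (a j / fact j) j"] allI impI)
  fix i assume "i \<le> K"
  then have "coeff (\<Sum>j\<le>K. monom (a j / fact j) j) i = a i / fact i"
    by (simp add: coeff_sum)
  then show "poly ((pderiv ^^ i) (\<Sum>j\<le>K. monom (a j / fact j) j)) 0 = a i"
    by (simp add: poly_0_coeff_0 coeff_higher_pderiv flip: pochhammer_fact)
qed

text \<open>Substitute for the variables polynomials whose derivatives at \<open>0\<close> are powers \<open>T ^ w\<close> with separating
  weights \<open>w\<close>. The value at \<open>0\<close> of a linear combination of monomials is
  then a polynomial in \<open>T\<close> with the same coefficients. It vanishes for all \<open>T\<close> in the field, which is
  infinite.\<close>
lemma differential_monomials_independent:
  fixes c :: "('v \<times> nat) multiset \<Rightarrow> 'k::field_char_0"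
  assumes "finite M"
    and zero: "\<And>\<rho>. (\<Sum>m\<in>M. smult (c m) (differential_monomial \<rho> m)) = 0"
    and "m \<in> M"
  shows "c m = 0"
proof -
  obtain w :: "'v \<times> nat \<Rightarrow> nat" where w: "inj_on (\<lambda>m. \<Sum>x\<in>#m. w x) M"
    using ex_separating_weight[OF assms(1)] by blast
  define W where "W m = (\<Sum>x\<in>#m. w x)" for m
  define K where "K = Max (snd ` (\<Union>m\<in>M. set_mset m))"
  have K: "snd p \<le> K" if "m \<in> M" "p \<in># m" for m p
    unfolding K_def using that assms(1) by (intro Max_ge) auto
  define P where "P = (\<Sum>m\<in>M. monom (c m) (W m))"
  have "poly P T = 0" for T
  proof -
    have "\<forall>v. \<exists>f :: 'k poly. \<forall>i\<le>K. poly ((pderiv ^^ i) f) 0 = T ^ w (v, i)"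
      by (intro allI ex_polynomial_jet)
    then obtain \<rho> :: "'v \<Rightarrow> 'k poly"
      where \<rho>: "\<And>v i. i \<le> K \<Longrightarrow> poly ((pderiv ^^ i) (\<rho> v)) 0 = T ^ w (v, i)"
      by metis
    have "poly (differential_monomial \<rho> m) 0 = T ^ W m" if "m \<in> M" for m
    proof -
      have "poly (differential_monomial \<rho> k) 0 = T ^ W k" if "k \<subseteq># m" for k
        using that
      proof (induction k)
        case (add p k)
        then have "p \<in># m" by (meson mset_subset_eq_insertD)
        with K[OF \<open>m \<in> M\<close>] have "poly ((pderiv ^^ snd p) (\<rho> (fst p))) 0 = T ^ w p"
          using \<rho>[of "snd p" "fst p"] by simp
        moreover have "k \<subseteq># m"
          using add.prems by (meson mset_subset_eq_insertD subset_mset.less_imp_le)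
        ultimately show ?case
          using add.IH by (simp add: differential_monomial_def W_def power_add)
      qed (simp add: differential_monomial_def W_def)
      then show ?thesis by simp
    qed
    then have "poly P T = poly (\<Sum>m\<in>M. smult (c m) (differential_monomial \<rho> m)) 0"
      by (simp add: P_def poly_sum poly_monom)
    then show ?thesis by (simp add: zero)
  qed
  then have "P = 0" by (simp add: poly_all_0_iff_0[symmetric])
  have "(\<Sum>k\<in>M. if W k = W m then c k else 0) = (\<Sum>k\<in>M. if k = m then c k else 0)"
    by (rule sum.cong) (use w assms(3) in \<open>auto simp: W_def inj_on_def\<close>)
  then have "coeff P (W m) = c m"
    using assms(1,3) by (simp add: P_def coeff_sum)
  then show ?thesis by (simp add: \<open>P = 0\<close>)
qed

section \<open>Expansion of words into monomials\<close>

text \<open>The multiset of monomials whose sum is the word in the free differential algebra, for the product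
  \<open>f' g\<close>. All coefficients are natural numbers, which is why a multiset can hold them.\<close>
primrec expansion :: "'v magma \<Rightarrow> ('v \<times> nat) multiset multiset" where
  "expansion (Gen v) = {#{#(v, 0)#}#}"
| "expansion (Prod s t) =
    (\<Sum>m\<in>#expansion s. \<Sum>k\<in>#expansion t. image_mset (\<lambda>p. raise m p + k) m)"

lemma in_sum_mset_iff: "x \<in># (\<Sum>m\<in>#M. F m) \<longleftrightarrow> (\<exists>m\<in>#M. x \<in># F m)"
  by (induction M) auto

lemma sum_mset_image_sum_mset:
  "(\<Sum>x\<in>#(\<Sum>m\<in>#M. F m). g x) = (\<Sum>m\<in>#M. \<Sum>x\<in>#F m. g x)"
  by (induction M) simp_all

lemma balanced_expansion: "m \<in># expansion t \<Longrightarrow> balanced m"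
proof (induction t arbitrary: m)
  case (Gen v)
  then show ?case by (simp add: balanced_def)
next
  case (Prod s t)
  then show ?case by (auto simp: in_sum_mset_iff intro!: balanced_raise_add)
qed

lemma evaluate_magma_poly_deriv_alg:
  "evaluate_magma poly_deriv_alg \<rho> t = (\<Sum>m\<in>#expansion t. differential_monomial \<rho> m)"
proof (induction t)
  case (Gen v)
  then show ?case by (simp add: differential_monomial_def)
next
  case (Prod s t)
  have product: "pderiv (differential_monomial \<rho> m) * differential_monomial \<rho> k
      = (\<Sum>p\<in>#m. differential_monomial \<rho> (raise m p + k))" for m k
    unfolding pderiv_differential_monomial
    by (simp add: sum_mset_distrib_right differential_monomial_def)
  have "evaluate_magma poly_deriv_alg \<rho> (Prod s t)
      = pderiv (evaluate_magma poly_deriv_alg \<rho> s) * evaluate_magma poly_deriv_alg \<rho> t"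
    by (simp add: poly_deriv_alg_def)
  also have "\<dots> = (\<Sum>m\<in>#expansion s. pderiv (differential_monomial \<rho> m)
      * (\<Sum>k\<in>#expansion t. differential_monomial \<rho> k))"
    by (simp only: Prod.IH pderiv_sum_mset sum_mset_distrib_right)
  also have "\<dots> = (\<Sum>m\<in>#expansion (Prod s t). differential_monomial \<rho> m)"
    by (simp add: sum_mset_distrib_left product sum_mset_image_sum_mset multiset.map_comp comp_def)
  finally show ?case .
qed

context novikov_ring
begin

lemma evaluate_magma_eq_monomial_values:
  assumes "mul C = (\<cdot>)"
  shows "evaluate_magma C \<rho> t =
    (\<Sum>m\<in>#expansion t. monomial_value (image_mset (map_prod \<rho> id) m))"
proof (induction t)
  case (Gen v)
  then show ?case by (simp add: monomial_value_single)
next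
  case (Prod s t)
  have product: "monomial_value (image_mset (map_prod \<rho> id) m) \<cdot> monomial_value (image_mset (map_prod \<rho> id) k)
      = (\<Sum>p\<in>#m. monomial_value (image_mset (map_prod \<rho> id) (raise m p + k)))"
    if "m \<in># expansion s" "k \<in># expansion t" for m k
  proof -
    have bal: "balanced (image_mset (map_prod \<rho> id) n)" if "balanced n" for n
      using that by (simp add: balanced_def multiset.map_comp comp_def)
    have raise: "raise (image_mset (map_prod \<rho> id) m) (map_prod \<rho> id p)
        = image_mset (map_prod \<rho> id) (raise m p)" if "p \<in># m" for p
      using that by (simp add: raise_def image_mset_Diff)
    show ?thesis
      using monomial_value_product[OF bal bal, OF that[THEN balanced_expansion]]
      by (simp add: multiset.map_comp comp_def raise cong: multiset.map_cong)
  qed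
  let ?val = "\<lambda>m. monomial_value (image_mset (map_prod \<rho> id) m)"
  have "evaluate_magma C \<rho> (Prod s t) = (\<Sum>m\<in>#expansion s. ?val m \<cdot> (\<Sum>k\<in>#expansion t. ?val k))"
    by (simp only: evaluate_magma.simps assms Prod.IH sum_mset_left)
  also have "\<dots> = (\<Sum>m\<in>#expansion (Prod s t). ?val m)"
    by (simp add: product sum_mset_right sum_mset_image_sum_mset multiset.map_comp comp_def
        cong: multiset.map_cong)
  finally show ?case .
qed

end

text \<open>A finite set containing all monomials with nonzero coefficient; cancellation can make some
  coefficients in it \<open>0\<close>.\<close>
definition monomials :: "('k::field, 'v) free_nonassoc \<Rightarrow> ('v \<times> nat) multiset set" where
  "monomials f = (\<Union>t\<in>Poly_Mapping.keys f. set_mset (expansion t))"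

definition monomial_coeff :: "('k::field, 'v) free_nonassoc \<Rightarrow> ('v \<times> nat) multiset \<Rightarrow> 'k" where
  "monomial_coeff f m =
    (\<Sum>t\<in>Poly_Mapping.keys f. Poly_Mapping.lookup f t * of_nat (count (expansion t) m))"

lemma finite_monomials: "finite (monomials f)"
  by (simp add: monomials_def)

text \<open>This applies both to \<open>k[x]\<close> and to an arbitrary Novikov algebra, with the same coefficients; only the
  values \<open>g m\<close> of the monomials differ.\<close>
lemma evaluate_eq_monomials:
  assumes B: "nonassoc_algebra B"
    and words: "\<And>t. evaluate_magma B \<rho> t = (\<Sum>m\<in>#expansion t. g m)"
  shows "evaluate B \<rho> f = (\<Sum>m\<in>monomials f. smul B (monomial_coeff f m) (g m))"
proof -
  interpret vector_space "smul B" using B by (simp add: nonassoc_algebra_def)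
  have collect: "(\<Sum>m\<in>#M. g m) = (\<Sum>m\<in>S. smul B (of_nat (count M m)) (g m))"
    if "finite S" "set_mset M \<subseteq> S" for M S
    using that(2)
  proof (induction M)
    case (add a M)
    have "(\<Sum>m\<in>S. smul B (of_nat (count (add_mset a M) m)) (g m))
        = (\<Sum>m\<in>S. (if m = a then g m else 0) + smul B (of_nat (count M m)) (g m))"
      by (intro sum.cong) (simp_all add: scale_left_distrib)
    then show ?case
      using add that(1) by (simp add: sum.distrib)
  qed simp
  have "evaluate_magma B \<rho> t = (\<Sum>m\<in>monomials f. smul B (of_nat (count (expansion t) m)) (g m))"
    if "t \<in> Poly_Mapping.keys f" for t
    unfolding words by (rule collect[OF finite_monomials]) (use that in \<open>auto simp: monomials_def\<close>)
  then have "evaluate B \<rho> f = (\<Sum>t\<in>Poly_Mapping.keys f. \<Sum>m\<in>monomials f.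
      smul B (Poly_Mapping.lookup f t * of_nat (count (expansion t) m)) (g m))"
    by (simp add: evaluate_def scale_sum_right)
  also have "\<dots> = (\<Sum>m\<in>monomials f. smul B (monomial_coeff f m) (g m))"
    by (subst sum.swap) (simp add: monomial_coeff_def scale_sum_left)
  finally show ?thesis .
qed

section \<open>The variety generated by the polynomial algebra\<close>

lemma nonassoc_algebra_poly_deriv_alg:
  "nonassoc_algebra (poly_deriv_alg :: ('k::field, 'k poly) alg)"
proof -
  have "vector_space (smult :: 'k \<Rightarrow> _)"
    by standard (simp_all add: smult_add_right smult_add_left)
  then show ?thesis
    by (simp add: nonassoc_algebra_def poly_deriv_alg_def Vector_Spaces.linear_iff pderiv_add
        pderiv_smult algebra_simps)
qed

lemma poly_deriv_alg_Novikov: "(poly_deriv_alg :: ('k::field, 'k poly) alg) \<in> Novikov"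
  using nonassoc_algebra_poly_deriv_alg
  by (simp add: Novikov_def poly_deriv_alg_def pderiv_mult algebra_simps)

lemma novikov_ring_mul:
  assumes "C \<in> Novikov"
  shows "novikov_ring (mul C)"
  using assms
  by unfold_locales (auto simp: Novikov_def nonassoc_algebra_def Vector_Spaces.linear_iff)

lemma Novikov_subset_Var:
  "Novikov \<subseteq> Var (poly_deriv_alg :: ('k::field_char_0, 'k poly) alg)"
proof
  fix C :: "('k, 'b::ab_group_add) alg"
  assume C: "C \<in> Novikov"
  then have alg: "nonassoc_algebra C" by (simp add: Novikov_def)
  interpret novikov_ring "mul C" using C by (rule novikov_ring_mul)
  interpret vector_space "smul C" using alg by (simp add: nonassoc_algebra_def)
  have "satisfies C f" if f: "satisfies (poly_deriv_alg :: ('k, 'k poly) alg) f" for f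
  proof -
    have "(\<Sum>m\<in>monomials f. smult (monomial_coeff f m) (differential_monomial \<rho> m)) = 0" for \<rho>
      using f evaluate_eq_monomials[OF nonassoc_algebra_poly_deriv_alg evaluate_magma_poly_deriv_alg, of \<rho> f]
      by (simp add: satisfies_def poly_deriv_alg_def)
    then have "monomial_coeff f m = 0" if "m \<in> monomials f" for m
      using differential_monomials_independent[OF finite_monomials] that by blast
    then show ?thesis
      unfolding satisfies_def evaluate_eq_monomials[OF alg evaluate_magma_eq_monomial_values[OF refl]]
      by simp
  qed
  with alg show "C \<in> Var (poly_deriv_alg :: ('k, 'k poly) alg)"
    by (simp add: Var_def)
qed

text \<open>Both laws of Novikov algebras take the form \<open>(s - t) - (s' - t') = 0\<close> for words; for left
  commutativity, \<open>s'\<close> and \<open>t'\<close> are equal.\<close>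
definition difference_of_differences ::
  "nat magma \<Rightarrow> nat magma \<Rightarrow> nat magma \<Rightarrow> nat magma \<Rightarrow> ('k::field, nat) free_nonassoc" where
  "difference_of_differences s t s' t' =
    Poly_Mapping.single s 1 + Poly_Mapping.single t (- 1)
    + Poly_Mapping.single s' (- 1) + Poly_Mapping.single t' 1"

lemma evaluate_difference_of_differences:
  assumes "nonassoc_algebra B"
  shows "evaluate B \<rho> (difference_of_differences s t s' t') =
    (evaluate_magma B \<rho> s - evaluate_magma B \<rho> t) - (evaluate_magma B \<rho> s' - evaluate_magma B \<rho> t')"
proof -
  interpret vector_space "smul B" using assms by (simp add: nonassoc_algebra_def)
  show ?thesis
    by (simp add: difference_of_differences_def evaluate_add[OF assms] evaluate_single[OF assms])
qed

lemma Var_subset_Novikov: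
  fixes B :: "('k::field, 'a::ab_group_add) alg"
  assumes "B \<in> Novikov"
  shows "Var B \<subseteq> Novikov"
proof
  fix C :: "('k, 'b::ab_group_add) alg"
  assume "C \<in> Var B"
  then have C: "nonassoc_algebra C" and sat: "\<And>f. satisfies B f \<Longrightarrow> satisfies C f"
    by (auto simp: Var_def)
  from assms have B: "nonassoc_algebra B" by (simp add: Novikov_def)
  have transfer: "(evaluate_magma C \<rho> s - evaluate_magma C \<rho> t)
      - (evaluate_magma C \<rho> s' - evaluate_magma C \<rho> t') = 0"
    if "\<And>\<sigma>. (evaluate_magma B \<sigma> s - evaluate_magma B \<sigma> t)
      - (evaluate_magma B \<sigma> s' - evaluate_magma B \<sigma> t') = 0" for \<rho> and s t s' t' :: "nat magma"
    using that sat[of "difference_of_differences s t s' t'"]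
    by (simp add: satisfies_def evaluate_difference_of_differences[OF B] evaluate_difference_of_differences[OF C])
  let ?x = "Gen 0" and ?y = "Gen 1" and ?z = "Gen 2 :: nat magma"
  have "mul C (mul C a b) c - mul C a (mul C b c) = mul C (mul C a c) b - mul C a (mul C c b)" for a b c
    using transfer[of "Prod (Prod ?x ?y) ?z" "Prod ?x (Prod ?y ?z)" "Prod (Prod ?x ?z) ?y"
        "Prod ?x (Prod ?z ?y)" "\<lambda>n. if n = 0 then a else if n = 1 then b else c"] assms
    by (simp add: Novikov_def)
  moreover have "mul C a (mul C b c) = mul C b (mul C a c)" for a b c
    using transfer[of "Prod ?x (Prod ?y ?z)" "Prod ?y (Prod ?x ?z)" ?x ?x
        "\<lambda>n. if n = 0 then a else if n = 1 then b else c"] assms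
    by (simp add: Novikov_def)
  ultimately show "C \<in> Novikov"
    using C by (simp add: Novikov_def)
qed

theorem corollary4:
  shows "(poly_deriv_alg :: ('k::field_char_0, 'k poly) alg) \<in> Novikov \<and>
    (Novikov :: ('k, 'b::ab_group_add) alg set) = Var (poly_deriv_alg :: ('k, 'k poly) alg)"
  using poly_deriv_alg_Novikov Novikov_subset_Var Var_subset_Novikov[OF poly_deriv_alg_Novikov]
  by blast

end
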